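(* Let $\mathcal{V}$ be a finite vocabulary with $|\mathcal{V}|\ge 2$, let $l\in\mathbb{R}^{|\mathcal{V}|}$ be a logits vector, and let $p=\mathrm{softmax}(l)$, i.e. $p[i]=e^{l[i]}/\sum_{j\in\mathcal{V}}e^{l[j]}$. Let $\xi=(\xi[i])_{i\in\mathcal{V}}$ have i.i.d. $\mathrm{Gumbel}(0,1)$ coordinates (CDF $F(x)=e^{-e^{-x}}$), and define the per-token score of a token $w\in\mathcal{V}$ as $s=\xi[w]$. (1) (Watermarked token.) Let $w^\ast=\operatorname{argmax}_{i\in\mathcal{V}}\,(l[i]+\xi[i])$ (the Logits-Addition watermarked token). Then for every $w\in\mathcal{V}$, conditionally on the event $\{w^\ast=w\}$, the score $s=\xi[w]$ satisfies $$\mathbb{E}[s\mid w^\ast=w]=-\log p[w]+\gamma,\qquad \mathrm{Var}[s\mid w^\ast=w]\le \frac{2\,p[w]^2}{(1-p[w])^3}+\frac{2}{p[w]}-\bigl(-\log p[w]+\gamma\bigr)^2 .$$ (2) (Unwatermarked token.) If $w$ is a token (fixed or random) chosen independently of $\xi$, then the score $s=\xi[w]$ satisfies $$\mathbb{E}[s]=\gamma,\qquad \mathrm{Var}[s]=\frac{\pi^2}{6}.$$ Here $\gamma$ denotes the Euler–Mascheroni constant.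
   Context: This describes one decoding step of the Logits-Addition watermark: at position $t$ a language model gives a logits vector $l=l_t$ for the next token, a watermark key $\xi=\xi_t$ (a vector of independent standard Gumbel random variables indexed by the vocabulary) is drawn, the next token is generated as $w_t=\operatorname{argmax}_i(l_t[i]+\xi_t[i])$, and the detector assigns the per-token score $s_t=\xi_t[w_t]$. For unwatermarked (e.g. human-written) text, the token $w_t$ has no dependence on the key $\xi_t$. The standard Gumbel$(0,1)$ distribution has density $e^{-(x+e^{-x})}$ on $\mathbb{R}$. *)

theory Defs
  imports "HOL-Probability.Probability"
begin

definition gumbel_density :: "real \<Rightarrow> real" where
  "gumbel_density x = exp (-(x + exp (-x)))"

definition softmax :: "('v::finite \<Rightarrow> real) \<Rightarrow> 'v \<Rightarrow> real" where
  "softmax l w = exp (l w) / (\<Sum>j\<in>UNIV. exp (l j))"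

definition cond_expectation :: "'a measure \<Rightarrow> 'a set \<Rightarrow> ('a \<Rightarrow> real) \<Rightarrow> real" where
  "cond_expectation M A X = (\<integral>\<omega>. indicator A \<omega> * X \<omega> \<partial>M) / measure M A"

definition cond_variance :: "'a measure \<Rightarrow> 'a set \<Rightarrow> ('a \<Rightarrow> real) \<Rightarrow> real" where
  "cond_variance M A X =
     cond_expectation M A (\<lambda>\<omega>. (X \<omega> - cond_expectation M A X)\<^sup>2)"

text \<open>The event that token w is the argmax of l[i] + xi[i] (the Logits-Addition
  watermarked token). Ties have probability zero.\<close>
definition wm_event :: "'a measure \<Rightarrow> ('v \<Rightarrow> real) \<Rightarrow> ('v \<Rightarrow> 'a \<Rightarrow> real) \<Rightarrow> 'v \<Rightarrow> 'a set" where
  "wm_event M l \<xi> w = {\<omega> \<in> space M. \<forall>j. l j + \<xi> j \<omega> \<le> l w + \<xi> w \<omega>}"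

end

theory Submission
  imports Defs
begin

text \<open>
  Multiplying the Gumbel density at \<open>x\<close> by the probability that no \<open>j \<noteq> w\<close> beats \<open>l w + x\<close>
  gives \<open>p\<close> times the Gumbel density at \<open>x + ln p\<close>, where \<open>p = softmax l w\<close>. So conditionally on
  being selected, the score is a standard Gumbel variable shifted by \<open>- ln p\<close>: its mean is
  \<open>\<gamma> - ln p\<close> and its variance is exactly \<open>pi\<^sup>2 / 6\<close>. The moments themselves come from the
  moment generating function \<open>u \<mapsto> \<Gamma>(1 - u)\<close>, differentiated twice at 0. Finally, with
  \<open>x = - ln p\<close>, the estimate \<open>2 exp x \<ge> 2 + 2 x + x\<^sup>2\<close> and the numerical fact
  \<open>\<gamma>\<^sup>2 + pi\<^sup>2 / 6 < 2\<close> show that the claimed variance bound exceeds \<open>pi\<^sup>2 / 6\<close>.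
\<close>

section \<open>Differentiating exponential moments under the integral sign\<close>

lemma power_le_fact_exp:
  fixes y :: real
  assumes "0 \<le> y"
  shows "y ^ k \<le> fact k * exp y"
proof -
  have "(\<Sum>n\<in>{k}. y ^ n /\<^sub>R fact n) \<le> (\<Sum>n. y ^ n /\<^sub>R fact n)"
    using assms by (intro sum_le_suminf summable_exp_generic) auto
  then show ?thesis
    by (simp add: exp_def field_simps)
qed

text \<open>The gap between the rates \<open>r\<close> and \<open>s\<close> absorbs the power:
  \<open>power_le_fact_exp\<close> is applied to \<open>(s - r) * \<bar>y\<bar>\<close>. Since
  \<open>\<bar>y\<bar>\<close> is \<open>y\<close> or \<open>- y\<close>, the factor
  \<open>exp (s * \<bar>y\<bar>)\<close> is one of the two exponentials on the right, the kind whose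
  integrability is assumed in the next lemma.\<close>

lemma power_abs_exp_abs_le:
  fixes r s y :: real
  assumes "r < s"
  shows "\<bar>y\<bar> ^ k * exp (r * \<bar>y\<bar>) \<le> fact k / (s - r) ^ k * (exp (s * y) + exp (- s * y))"
proof -
  have "((s - r) * \<bar>y\<bar>) ^ k \<le> fact k * exp ((s - r) * \<bar>y\<bar>)"
    using assms by (intro power_le_fact_exp) auto
  then have "((s - r) * \<bar>y\<bar>) ^ k * exp (r * \<bar>y\<bar>) \<le> fact k * exp ((s - r) * \<bar>y\<bar>) * exp (r * \<bar>y\<bar>)"
    by (intro mult_right_mono) auto
  also have "\<dots> = fact k * exp (s * \<bar>y\<bar>)"
    by (simp add: mult.assoc exp_add[symmetric] algebra_simps)
  also have "\<dots> \<le> fact k * (exp (s * y) + exp (- s * y))"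
    by (intro mult_left_mono) (auto simp: abs_if)
  finally have "(\<bar>y\<bar> ^ k * exp (r * \<bar>y\<bar>)) * (s - r) ^ k \<le> fact k * (exp (s * y) + exp (- s * y))"
    by (simp only: power_mult_distrib ac_simps)
  then show ?thesis
    using assms by (simp add: pos_le_divide_eq)
qed

text \<open>Dominated convergence applied to the difference quotients, with majorant
  \<open>\<bar>X x\<bar> ^ Suc k * exp (b * \<bar>X x\<bar>)\<close> for some \<open>b\<close>
  strictly between \<open>\<bar>u\<bar>\<close> and \<open>a\<close>. The general \<open>k\<close>
  lets the rule be iterated: each derivative is again a moment of the same form.\<close>

lemma
  fixes X :: "'b \<Rightarrow> real"
  assumes int: "\<And>u. \<bar>u\<bar> < a \<Longrightarrow> integrable N (\<lambda>x. exp (u * X x))"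
    and [measurable]: "X \<in> borel_measurable N"
    and u: "\<bar>u\<bar> < a"
  shows integrable_power_exp: "integrable N (\<lambda>x. X x ^ k * exp (u * X x))" (is ?int)
    and has_derivative_exp_moment:
      "((\<lambda>u. \<integral>x. X x ^ k * exp (u * X x) \<partial>N) has_field_derivative
         (\<integral>x. X x ^ Suc k * exp (u * X x) \<partial>N)) (at u)" (is ?deriv)
proof -
  have dom: "integrable N (\<lambda>x. \<bar>X x\<bar> ^ k * exp (r * \<bar>X x\<bar>))" if r: "0 \<le> r" "r < a" for r k
  proof -
    obtain s where s: "r < s" "s < a"
      using dense r by blast
    have "integrable N (\<lambda>x. fact k / (s - r) ^ k * (exp (s * X x) + exp (- s * X x)))"
      using s r int[of s] int[of "- s"] by (intro integrable_mult_right integrable_add) auto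
    then show ?thesis
    proof (rule Bochner_Integration.integrable_bound)
      show "AE x in N. norm (\<bar>X x\<bar> ^ k * exp (r * \<bar>X x\<bar>))
              \<le> norm (fact k / (s - r) ^ k * (exp (s * X x) + exp (- s * X x)))"
        using power_abs_exp_abs_le[OF s(1)]
        by (intro AE_I2) (simp add: order_trans[OF _ abs_ge_self] del: abs_divide abs_mult)
    qed simp
  qed
  have le_abs: "v * y \<le> \<bar>v\<bar> * \<bar>y\<bar>" for v y :: real
    by (metis abs_ge_self abs_mult)
  have int': "integrable N (\<lambda>x. X x ^ k * exp (v * X x))" if v: "\<bar>v\<bar> < a" for v k
  proof (rule Bochner_Integration.integrable_bound[OF dom[of "\<bar>v\<bar>" k]])
    show "AE x in N. norm (X x ^ k * exp (v * X x)) \<le> norm (\<bar>X x\<bar> ^ k * exp (\<bar>v\<bar> * \<bar>X x\<bar>))"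
      by (intro AE_I2) (auto simp: abs_mult power_abs le_abs intro!: mult_left_mono)
  qed (use v in auto)
  show ?int by (rule int'[OF u])
  obtain b where b: "\<bar>u\<bar> < b" "b < a"
    using dense u by blast
  show ?deriv
    unfolding has_field_derivative_iff
  \<comment> \<open>Near \<open>u\<close>, the difference quotient of the integrals is replaced by
    the integral of the pointwise difference quotient \<open>?q\<close>.\<close>
  proof (subst tendsto_cong)
    let ?q = "\<lambda>v x. X x ^ k * ((exp (v * X x) - exp (u * X x)) / (v - u))"
    have "eventually (\<lambda>v. \<bar>v\<bar> < b) (at u)"
      using b by (intro eventually_at_in_open'[of "{-b<..<b}" u, THEN eventually_mono]) auto
    then show "\<forall>\<^sub>F v in at u. ((\<integral>x. X x ^ k * exp (v * X x) \<partial>N) - (\<integral>x. X x ^ k * exp (u * X x) \<partial>N)) / (v - u)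
         = (\<integral>x. ?q v x \<partial>N)"
    proof eventually_elim
      case (elim v)
      have "(\<integral>x. ?q v x \<partial>N) = (\<integral>x. (X x ^ k * exp (v * X x) - X x ^ k * exp (u * X x)) / (v - u) \<partial>N)"
        by (simp add: right_diff_distrib)
      also have "\<dots> = (\<integral>x. X x ^ k * exp (v * X x) - X x ^ k * exp (u * X x) \<partial>N) / (v - u)"
        by (rule integral_divide_zero)
      also have "\<dots> = ((\<integral>x. X x ^ k * exp (v * X x) \<partial>N) - (\<integral>x. X x ^ k * exp (u * X x) \<partial>N)) / (v - u)"
        using elim b u int' by (subst Bochner_Integration.integral_diff) auto
      finally show ?case ..
    qed
    have bound: "\<bar>?q v x\<bar> \<le> \<bar>X x\<bar> ^ Suc k * exp (b * \<bar>X x\<bar>)" if v: "\<bar>v\<bar> < b" "v \<noteq> u" for v x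
    proof -
      \<comment> \<open>Mean value inequality in the exponent parameter over the interval from
        \<open>-b\<close> to \<open>b\<close>, which contains both \<open>u\<close> and
        \<open>v\<close>.\<close>
      have "\<bar>exp (v * X x) - exp (u * X x)\<bar> \<le> (\<bar>X x\<bar> * exp (b * \<bar>X x\<bar>)) * \<bar>v - u\<bar>"
      proof (rule field_differentiable_bound[of "{-b..b}" "\<lambda>v. exp (v * X x)" "\<lambda>v. X x * exp (v * X x)",
          simplified real_norm_def])
        fix z assume z: "z \<in> {-b..b}"
        show "((\<lambda>v. exp (v * X x)) has_field_derivative X x * exp (z * X x)) (at z within {- b..b})"
          by (auto intro!: derivative_eq_intros)
        have "z * X x \<le> \<bar>z\<bar> * \<bar>X x\<bar>" by (rule le_abs)
        also have "\<dots> \<le> b * \<bar>X x\<bar>" using z by (intro mult_right_mono) auto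
        finally show "\<bar>X x * exp (z * X x)\<bar> \<le> \<bar>X x\<bar> * exp (b * \<bar>X x\<bar>)"
          by (auto simp: abs_mult intro!: mult_left_mono)
      qed (use v b in auto)
      then have "\<bar>exp (v * X x) - exp (u * X x)\<bar> / \<bar>v - u\<bar> \<le> \<bar>X x\<bar> * exp (b * \<bar>X x\<bar>)"
        using v by (simp add: field_simps)
      from mult_left_mono[OF this, of "\<bar>X x\<bar> ^ k"] show ?thesis
        by (simp add: abs_mult power_abs ac_simps)
    qed
    show "((\<lambda>v. \<integral>x. ?q v x \<partial>N) \<longlongrightarrow> (\<integral>x. X x ^ Suc k * exp (u * X x) \<partial>N)) (at u)"
      unfolding tendsto_at_iff_sequentially comp_def
    proof (intro allI impI)
      fix V :: "nat \<Rightarrow> real" assume V: "\<forall>i. V i \<in> UNIV - {u}" "V \<longlonglongrightarrow> u"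
      have "eventually (\<lambda>i. V i \<in> {-b<..<b}) sequentially"
        using V(2) b by (intro topological_tendstoD) auto
      then obtain n0 where n0: "\<And>i. i \<ge> n0 \<Longrightarrow> \<bar>V i\<bar> < b"
        by (auto simp: eventually_sequentially abs_less_iff) force
      show "(\<lambda>i. \<integral>x. ?q (V i) x \<partial>N) \<longlonglongrightarrow> (\<integral>x. X x ^ Suc k * exp (u * X x) \<partial>N)"
      \<comment> \<open>The majorant is available only once \<open>\<bar>V i\<bar> < b\<close>, so
        the first \<open>n0\<close> terms of the sequence are discarded.\<close>
      proof (rule LIMSEQ_offset[of _ n0], rule integral_dominated_convergence)
        show "integrable N (\<lambda>x. \<bar>X x\<bar> ^ Suc k * exp (b * \<bar>X x\<bar>))"
          using b by (intro dom) auto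
        show "AE x in N. (\<lambda>i. ?q (V (i + n0)) x) \<longlonglongrightarrow> X x ^ Suc k * exp (u * X x)"
        proof (intro AE_I2)
          fix x
          have "((\<lambda>v. exp (v * X x)) has_field_derivative X x * exp (u * X x)) (at u)"
            by (auto intro!: derivative_eq_intros)
          then have "((\<lambda>v. (exp (v * X x) - exp (u * X x)) / (v - u)) \<longlongrightarrow> X x * exp (u * X x)) (at u)"
            by (simp add: has_field_derivative_iff)
          then have "(\<lambda>i. (exp (V i * X x) - exp (u * X x)) / (V i - u)) \<longlonglongrightarrow> X x * exp (u * X x)"
            using V unfolding tendsto_at_iff_sequentially comp_def by blast
          from tendsto_mult_left[OF LIMSEQ_ignore_initial_segment[OF this, of n0], of "X x ^ k"]
          show "(\<lambda>i. ?q (V (i + n0)) x) \<longlonglongrightarrow> X x ^ Suc k * exp (u * X x)"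
            by (simp add: ac_simps)
        qed
        show "AE x in N. norm (?q (V (i + n0)) x) \<le> \<bar>X x\<bar> ^ Suc k * exp (b * \<bar>X x\<bar>)" for i
          unfolding real_norm_def using V(1) n0 by (intro AE_I2 bound) auto
      qed measurable
    qed
  qed
qed

section \<open>The standard Gumbel law: generating function, moments, distribution function\<close>

lemma gumbel_density_nonneg [simp]: "0 \<le> gumbel_density x"
  by (simp add: gumbel_density_def)

lemma gumbel_density_measurable [measurable]: "gumbel_density \<in> borel_measurable borel"
  unfolding gumbel_density_def by measurable

abbreviation gumbel :: "real measure" where
  "gumbel \<equiv> density lborel (\<lambda>x. ennreal (gumbel_density x))"

text \<open>The substitution \<open>t = exp (- x)\<close> in Euler's integral of
  \<open>t powr (- u) / exp t\<close>: the Jacobian \<open>exp (- x)\<close> and the factor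
  \<open>exp (- t)\<close> together form the Gumbel density, and \<open>t powr (- u)\<close> becomes
  \<open>exp (u * x)\<close>.\<close>

lemma
  assumes u: "u < 1"
  shows gumbel_integrable_exp: "integrable gumbel (\<lambda>x. exp (u * x))" (is ?int)
    and gumbel_mgf: "(\<integral>x. exp (u * x) \<partial>gumbel) = Gamma (1 - u)" (is ?mgf)
proof -
  let ?f = "\<lambda>t::real. t powr (- u) / exp t"
  have "(?f has_integral Gamma (1 - u)) {0..}"
    using Gamma_integral_real[of "1 - u"] u by simp
  \<comment> \<open>The endpoint 0 is dropped because the image of the substitution is the open
    half-line.\<close>
  then have hi: "(?f has_integral Gamma (1 - u)) {0<..}"
    by (rule has_integral_spike_set_eq[THEN iffD1, rotated -1])
       (auto intro!: negligible_subset[OF negligible_sing[of 0]])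
  then have "?f absolutely_integrable_on {0<..}"
    by (intro nonnegative_absolutely_integrable_1) (auto simp: has_integral_iff)
  moreover have "range (\<lambda>x::real. exp (- x)) = {0<..}"
  proof safe
    fix y :: real assume "y > 0"
    then show "y \<in> range (\<lambda>x. exp (- x))" by (intro image_eqI[of _ _ "- ln y"]) auto
  qed auto
  ultimately have "(\<lambda>x. \<bar>- exp (- x)\<bar> * ?f (exp (- x))) absolutely_integrable_on UNIV \<and>
      integral UNIV (\<lambda>x. \<bar>- exp (- x)\<bar> * ?f (exp (- x))) = Gamma (1 - u)"
    using hi by (subst has_absolute_integral_change_of_variables_1')
      (auto simp: inj_on_def has_integral_iff intro!: derivative_eq_intros)
  moreover have "\<bar>- exp (- x)\<bar> * ?f (exp (- x)) = gumbel_density x * exp (u * x)" for x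
    by (simp add: gumbel_density_def powr_def exp_add[symmetric] exp_diff[symmetric] algebra_simps)
  ultimately have ai: "(\<lambda>x. gumbel_density x * exp (u * x)) absolutely_integrable_on UNIV"
      and I: "integral UNIV (\<lambda>x. gumbel_density x * exp (u * x)) = Gamma (1 - u)"
    by auto
  \<comment> \<open>Absolute integrability refers to the completed measure; for a Borel function it
    descends to \<open>lborel\<close>.\<close>
  then have int: "integrable lborel (\<lambda>x. gumbel_density x * exp (u * x))"
    by (simp add: set_integrable_def integrable_completion)
  then show ?int
    by (subst integrable_real_density) auto
  show ?mgf
    using I int by (subst integral_real_density) (auto simp: integral_lborel)
qed

lemma gumbel_integrable_power: "integrable gumbel (\<lambda>x. x ^ k)"
  using integrable_power_exp[of 1 gumbel "\<lambda>x. x" 0 k] gumbel_integrable_exp by simp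

text \<open>The moments are derivatives of the generating function at 0, and
  \<open>DERIV_unique\<close> equates them with the derivatives of \<open>Gamma (1 - u)\<close>. The
  values are \<open>- Digamma 1\<close> and \<open>(Digamma 1)\<^sup>2 + Polygamma 1 1\<close>, with
  \<open>Digamma 1 = - euler_mascheroni\<close>.\<close>

lemma
  shows gumbel_mean: "(\<integral>x. x \<partial>gumbel) = euler_mascheroni"
    and gumbel_second_moment: "(\<integral>x. x\<^sup>2 \<partial>gumbel) = euler_mascheroni\<^sup>2 + pi\<^sup>2 / 6"
proof -
  have not_Int: "1 - u \<notin> \<int>\<^sub>\<le>\<^sub>0" if "\<bar>u\<bar> < 1" for u :: real
    using that by (auto elim!: nonpos_Ints_cases')
  have D': "((\<lambda>u. \<integral>x. x ^ k * exp (u * x) \<partial>gumbel) has_field_derivative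
         (\<integral>x. x ^ Suc k * exp (u * x) \<partial>gumbel)) (at u)" if "\<bar>u\<bar> < 1" for u k
    using has_derivative_exp_moment[of 1 gumbel "\<lambda>x. x" u k] gumbel_integrable_exp that by auto
  have ev: "\<forall>\<^sub>F v in nhds u. v \<in> {-1<..<1}" if "\<bar>u\<bar> < 1" for u :: real
    using that by (intro eventually_nhds_in_open) auto
  \<comment> \<open>Established on a whole neighbourhood of 0, since this identity is differentiated
    once more below.\<close>
  have first: "(\<integral>x. x * exp (u * x) \<partial>gumbel) = - (Gamma (1 - u) * Digamma (1 - u))" if u: "\<bar>u\<bar> < 1" for u
  proof (rule DERIV_unique)
    show "((\<lambda>u. \<integral>x. exp (u * x) \<partial>gumbel) has_field_derivative (\<integral>x. x * exp (u * x) \<partial>gumbel)) (at u)"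
      using D'[OF u, of 0] by simp
    have "((\<lambda>u. Gamma (1 - u)) has_field_derivative - (Gamma (1 - u) * Digamma (1 - u))) (at u)"
      using not_Int[OF u] by (auto intro!: derivative_eq_intros)
    then show "((\<lambda>u. \<integral>x. exp (u * x) \<partial>gumbel) has_field_derivative - (Gamma (1 - u) * Digamma (1 - u))) (at u)"
      by (rule DERIV_cong_ev[THEN iffD2, rotated -1, OF _ refl _ refl])
         (use ev[OF u] in eventually_elim, auto simp: gumbel_mgf)
  qed
  show "(\<integral>x. x \<partial>gumbel) = euler_mascheroni"
    using first[of 0] by simp
  have "(\<integral>x. x\<^sup>2 * exp (0 * x) \<partial>gumbel) = Gamma 1 * (Digamma 1)\<^sup>2 + Gamma 1 * Polygamma 1 1"
  proof (rule DERIV_unique)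
    show "((\<lambda>u. \<integral>x. x * exp (u * x) \<partial>gumbel) has_field_derivative (\<integral>x. x\<^sup>2 * exp (0 * x) \<partial>gumbel)) (at 0)"
      using D'[of 0 1] by (simp add: power2_eq_square)
    have "((\<lambda>u. - (Gamma (1 - u) * Digamma (1 - u))) has_field_derivative
        Gamma 1 * (Digamma 1)\<^sup>2 + Gamma 1 * Polygamma 1 1) (at (0::real))"
      using not_Int[of 0] by (auto intro!: derivative_eq_intros simp: power2_eq_square)
    then show "((\<lambda>u. \<integral>x. x * exp (u * x) \<partial>gumbel) has_field_derivative
        Gamma 1 * (Digamma 1)\<^sup>2 + Gamma 1 * Polygamma 1 1) (at 0)"
      by (rule DERIV_cong_ev[THEN iffD2, rotated -1, OF _ refl _ refl])
         (use ev[of 0, simplified] in eventually_elim, auto simp: first)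
  qed
  \<comment> \<open>The series of the trigamma function at 1 is the Basel series.\<close>
  moreover have "Polygamma 1 (1::real) = pi\<^sup>2 / 6"
    using sums_unique2[OF Polygamma_LIMSEQ[of "1::real" 1]] inverse_squares_sums
    by (simp add: power2_eq_square field_simps)
  ultimately show "(\<integral>x. x\<^sup>2 \<partial>gumbel) = euler_mascheroni\<^sup>2 + pi\<^sup>2 / 6"
    by simp
qed

lemma emeasure_gumbel_atMost: "emeasure gumbel {..a} = ennreal (exp (- exp (- a)))"
proof -
  have "emeasure gumbel {..a} = (\<integral>\<^sup>+x. ennreal (gumbel_density x) * indicator {..a} x \<partial>lborel)"
    by (simp add: emeasure_density)
  \<comment> \<open>Reflection turns the left half-line into a right one, where
    \<open>nn_integral_FTC_atLeast\<close> applies with the antiderivative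
    \<open>- exp (- exp x)\<close>, which tends to 0.\<close>
  also have "\<dots> = (\<integral>\<^sup>+x. ennreal (gumbel_density (- x)) * indicator {- a..} x \<partial>lborel)"
    by (subst nn_integral_real_affine[where c="-1" and t=0])
       (auto intro!: nn_integral_cong simp: indicator_def)
  also have "\<dots> = ennreal (0 - (- exp (- exp (- a))))"
  proof (rule nn_integral_FTC_atLeast)
    show "((\<lambda>x. - exp (- exp x)) has_real_derivative gumbel_density (- x)) (at x)" for x
      by (auto intro!: derivative_eq_intros simp: gumbel_density_def exp_diff exp_minus field_simps)
    have "((\<lambda>x::real. exp (- exp x)) \<longlongrightarrow> 0) at_top"
      by (intro filterlim_compose[OF exp_at_bot] filterlim_compose[OF filterlim_uminus_at_bot_at_top] exp_at_top)
    from tendsto_minus[OF this] show "((\<lambda>x::real. - exp (- exp x)) \<longlongrightarrow> 0) at_top" by simp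
  qed auto
  finally show ?thesis by simp
qed

text \<open>The total mass is the limit at infinity of the distribution function just
  computed.\<close>

lemma prob_space_gumbel: "prob_space gumbel"
proof -
  have "(\<lambda>n. emeasure gumbel {..real n}) \<longlonglongrightarrow> emeasure gumbel (\<Union>n. {..real n})"
    by (intro Lim_emeasure_incseq) (auto simp: incseq_def)
  moreover have "(\<Union>n. {..real n}) = UNIV"
    using real_arch_simple by auto
  moreover have "(\<lambda>n. exp (- exp (- real n))) \<longlonglongrightarrow> exp (- 0)"
    by (intro tendsto_intros filterlim_compose[OF exp_at_bot]
        filterlim_compose[OF filterlim_uminus_at_bot_at_top] filterlim_real_sequentially)
  then have "(\<lambda>n. emeasure gumbel {..real n}) \<longlonglongrightarrow> ennreal 1"
    unfolding emeasure_gumbel_atMost by (intro tendsto_ennrealI) simp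
  ultimately have "emeasure gumbel UNIV = 1"
    using LIMSEQ_unique by fastforce
  then show ?thesis by (intro prob_spaceI) simp
qed

lemma
  shows gumbel_mean_shift: "(\<integral>x. x - c \<partial>gumbel) = euler_mascheroni - c"
    and gumbel_variance: "(\<integral>x. (x - euler_mascheroni)\<^sup>2 \<partial>gumbel) = pi\<^sup>2 / 6"
proof -
  interpret prob_space gumbel by (rule prob_space_gumbel)
  note int = gumbel_integrable_power[of 1, simplified] gumbel_integrable_power[of 2]
  show "(\<integral>x. x - c \<partial>gumbel) = euler_mascheroni - c"
    using int gumbel_mean prob_space by simp
  have "(\<integral>x. (x - euler_mascheroni)\<^sup>2 \<partial>gumbel) = variance (\<lambda>x. x)"
    by (simp add: gumbel_mean)
  also have "\<dots> = (\<integral>x. x\<^sup>2 \<partial>gumbel) - (\<integral>x. x \<partial>gumbel)\<^sup>2"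
    using int by (intro variance_eq)
  also have "\<dots> = pi\<^sup>2 / 6"
    unfolding gumbel_mean gumbel_second_moment by simp
  finally show "(\<integral>x. (x - euler_mascheroni)\<^sup>2 \<partial>gumbel) = pi\<^sup>2 / 6" .
qed

section \<open>Law of the score on the event that a given token is selected\<close>

lemma softmax_pos: "0 < softmax l w"
  unfolding softmax_def by (intro divide_pos_pos sum_pos) auto

text \<open>A second token contributes a positive term to the denominator. Strictness keeps
  \<open>1 - softmax l w\<close> positive in the variance bound.\<close>

lemma softmax_less_1:
  fixes l :: "'v::finite \<Rightarrow> real"
  assumes "CARD('v) \<ge> 2"
  shows "softmax l w < 1"
proof -
  obtain v where "v \<noteq> w"
  proof (rule ccontr)
    assume "\<not> thesis"
    then have "UNIV = {w}" using that by blast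
    then have "CARD('v) = card {w}" by (rule arg_cong)
    with assms show False by simp
  qed
  then have "(\<Sum>j\<in>{w}. exp (l j)) < (\<Sum>j\<in>UNIV. exp (l j))"
    by (intro sum_strict_mono2[of _ _ v]) auto
  then show ?thesis
    by (simp add: softmax_def divide_less_eq) (smt (verit) exp_gt_zero)
qed

text \<open>This is the max-stability of the Gumbel law. The inner exponentials add up to
  \<open>exp (- x) / p = exp (- (x + ln p))\<close> with \<open>p = softmax l w\<close>, and the
  remaining factor \<open>exp (- x)\<close> equals \<open>p * exp (- (x + ln p))\<close>.\<close>

lemma gumbel_density_tilt:
  "gumbel_density x * (\<Prod>j\<in>UNIV - {w}. exp (- exp (l j - l w - x)))
     = softmax l w * gumbel_density (x + ln (softmax l w))"
proof -
  let ?p = "softmax l w"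
  note p = softmax_pos[of l w]
  have "exp (- x) * (1 + (\<Sum>j\<in>UNIV - {w}. exp (l j - l w))) = exp (- x) * (\<Sum>j\<in>UNIV. exp (l j - l w))"
    by (subst (2) sum.remove[of _ w]) auto
  also have "\<dots> = exp (- x) / ?p"
    by (simp add: softmax_def exp_diff sum_divide_distrib[symmetric])
  finally have "exp (- x) + (\<Sum>j\<in>UNIV - {w}. exp (l j - l w - x)) = exp (- x) / ?p"
    by (simp add: distrib_left sum_distrib_left exp_add[symmetric] algebra_simps)
  moreover have "gumbel_density x * (\<Prod>j\<in>UNIV - {w}. exp (- exp (l j - l w - x))) =
      exp (- x) * exp (- (exp (- x) + (\<Sum>j\<in>UNIV - {w}. exp (l j - l w - x))))"
    by (simp add: gumbel_density_def exp_sum[symmetric] exp_add[symmetric] sum_negf)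
  moreover have "?p * gumbel_density (x + ln ?p) = exp (- x) * exp (- (exp (- x) / ?p))"
  proof -
    have "exp (- (x + ln ?p)) = exp (- x) / ?p"
      using p by (simp add: exp_diff)
    moreover have "gumbel_density y = exp (- y) * exp (- exp (- y))" for y
      by (simp add: gumbel_density_def exp_add[symmetric])
    ultimately show ?thesis
      using p by simp
  qed
  ultimately show ?thesis by simp
qed

text \<open>Fubini isolates the coordinate \<open>w\<close> of the key. With its value fixed at
  \<open>x\<close>, the other coordinates contribute a product of distribution functions, which
  \<open>gumbel_density_tilt\<close> absorbs into a shifted density. Taking \<open>g\<close>
  nonnegative avoids integrability questions; constants and indicators for \<open>g\<close> later
  give the probability of the event and the law of the score.\<close>

lemma nn_integral_wm_event:
  fixes l :: "'v::finite \<Rightarrow> real" and \<xi> :: "'v \<Rightarrow> 'a \<Rightarrow> real"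
  assumes "prob_space M"
    and indep: "prob_space.indep_vars M (\<lambda>_. borel) \<xi> UNIV"
    and dist: "\<And>i. distributed M lborel (\<xi> i) (\<lambda>x. ennreal (gumbel_density x))"
    and g[measurable]: "g \<in> borel_measurable borel"
  shows "(\<integral>\<^sup>+\<omega>. indicator (wm_event M l \<xi> w) \<omega> * g (\<xi> w \<omega>) \<partial>M)
           = ennreal (softmax l w) * (\<integral>\<^sup>+x. g (x - ln (softmax l w)) \<partial>gumbel)"
proof -
  interpret prob_space M by fact
  interpret G: prob_space gumbel by (rule prob_space_gumbel)
  interpret P: product_sigma_finite "\<lambda>_::'v. gumbel" by unfold_locales
  let ?p = "softmax l w" and ?I = "UNIV - {w}"
  let ?h = "\<lambda>y. indicator {y. \<forall>j. l j + y j \<le> l w + y w} y * g (y w) :: ennreal"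
  have rv[measurable]: "\<xi> i \<in> borel_measurable M" for i
    using dist[of i] by (simp add: distributed_def)
  have "distr M borel (\<xi> i) = gumbel" for i
    using dist[of i] by (simp add: distributed_def cong: distr_cong)
  then have joint: "distr M (\<Pi>\<^sub>M i\<in>UNIV. borel) (\<lambda>\<omega>. \<lambda>i\<in>UNIV. \<xi> i \<omega>) = (\<Pi>\<^sub>M i\<in>UNIV. gumbel)"
    using indep indep_vars_iff_distr_eq_PiM[where I=UNIV and M'="\<lambda>_. borel" and X=\<xi>] by simp
  have sets: "sets (\<Pi>\<^sub>M i\<in>UNIV. gumbel) = sets (\<Pi>\<^sub>M i\<in>(UNIV::'v set). borel)"
    by (intro sets_PiM_cong) auto
  have comp: "(\<lambda>y. y i) \<in> borel_measurable (Pi\<^sub>M UNIV (\<lambda>_::'v. borel :: real measure))" for i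
    by (rule measurable_component_singleton) simp
  have "{y. \<forall>j. l j + y j \<le> l w + y w}
      = (\<Inter>j. {y \<in> space (Pi\<^sub>M UNIV (\<lambda>_. borel)). l j + y j \<le> l w + y w})"
    by (auto simp: space_PiM)
  also have "\<dots> \<in> sets (Pi\<^sub>M UNIV (\<lambda>_. borel))"
    using comp by (intro sets.finite_INT borel_measurable_le borel_measurable_add borel_measurable_const) auto
  finally have h[measurable]: "?h \<in> borel_measurable (\<Pi>\<^sub>M i\<in>UNIV. borel)"
    by (intro borel_measurable_times_ennreal borel_measurable_indicator measurable_compose[OF comp g])
  have "(\<integral>\<^sup>+\<omega>. indicator (wm_event M l \<xi> w) \<omega> * g (\<xi> w \<omega>) \<partial>M) = (\<integral>\<^sup>+\<omega>. ?h (\<lambda>i\<in>UNIV. \<xi> i \<omega>) \<partial>M)"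
    by (intro nn_integral_cong) (auto simp: wm_event_def indicator_def)
  also have "\<dots> = (\<integral>\<^sup>+y. ?h y \<partial>(\<Pi>\<^sub>M i\<in>UNIV. gumbel))"
    unfolding joint[symmetric] by (subst nn_integral_distr) auto
  also have "\<dots> = (\<integral>\<^sup>+y. ?h y \<partial>(\<Pi>\<^sub>M i\<in>insert w ?I. gumbel))"
    by (simp add: insert_absorb)
  also have "\<dots> = (\<integral>\<^sup>+x. (\<integral>\<^sup>+y. ?h (y(w := x)) \<partial>(\<Pi>\<^sub>M i\<in>?I. gumbel)) \<partial>gumbel)"
    using h by (intro P.product_nn_integral_insert_rev) (auto simp: insert_absorb cong: measurable_cong_sets[OF sets refl])
  also have "\<dots> = (\<integral>\<^sup>+x. ennreal (\<Prod>j\<in>?I. exp (- exp (l j - l w - x))) * g x \<partial>gumbel)"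
  proof (intro nn_integral_cong)
    fix x
    \<comment> \<open>Once \<open>y w = x\<close> is fixed, the event is a box in the other
      coordinates; the condition for \<open>j = w\<close> is trivial.\<close>
    have "?h (y(w := x)) = (\<Prod>j\<in>?I. indicator {..l w - l j + x} (y j)) * g x" for y
      by (auto simp: indicator_def algebra_simps intro!: prod.neutral[symmetric] split: if_splits)
    then have "(\<integral>\<^sup>+y. ?h (y(w := x)) \<partial>(\<Pi>\<^sub>M i\<in>?I. gumbel))
        = (\<integral>\<^sup>+y. (\<Prod>j\<in>?I. indicator {..l w - l j + x} (y j)) * g x \<partial>(\<Pi>\<^sub>M i\<in>?I. gumbel))"
      by simp
    also have "\<dots> = (\<integral>\<^sup>+y. (\<Prod>j\<in>?I. indicator {..l w - l j + x} (y j)) \<partial>(\<Pi>\<^sub>M i\<in>?I. gumbel)) * g x"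
      by (intro nn_integral_multc) auto
    also have "(\<integral>\<^sup>+y. (\<Prod>j\<in>?I. indicator {..l w - l j + x} (y j)) \<partial>(\<Pi>\<^sub>M i\<in>?I. gumbel))
        = (\<Prod>j\<in>?I. \<integral>\<^sup>+t. indicator {..l w - l j + x} t \<partial>gumbel)"
      by (intro P.product_nn_integral_prod) auto
    also have "\<dots> = ennreal (\<Prod>j\<in>?I. exp (- exp (l j - l w - x)))"
      by (subst prod_ennreal[symmetric]) (auto intro!: prod.cong simp: emeasure_gumbel_atMost)
    finally show "(\<integral>\<^sup>+y. ?h (y(w := x)) \<partial>(\<Pi>\<^sub>M i\<in>?I. gumbel))
        = ennreal (\<Prod>j\<in>?I. exp (- exp (l j - l w - x))) * g x" .
  qed
  also have "\<dots> = (\<integral>\<^sup>+x. ennreal ?p * (ennreal (gumbel_density (x + ln ?p)) * g x) \<partial>lborel)"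
    using softmax_pos[of l w]
    by (subst nn_integral_density)
       (auto intro!: nn_integral_cong simp: mult.assoc[symmetric] ennreal_mult[symmetric]
         gumbel_density_tilt prod_nonneg less_imp_le)
  also have "\<dots> = ennreal ?p * (\<integral>\<^sup>+x. ennreal (gumbel_density (x + ln ?p)) * g x \<partial>lborel)"
    by (intro nn_integral_cmult) auto
  \<comment> \<open>Translation by \<open>- ln ?p\<close> moves the shift from the density to the
    argument of \<open>g\<close>.\<close>
  also have "(\<integral>\<^sup>+x. ennreal (gumbel_density (x + ln ?p)) * g x \<partial>lborel)
      = (\<integral>\<^sup>+x. g (x - ln ?p) \<partial>gumbel)"
    by (subst nn_integral_real_affine[where c=1 and t="- ln ?p"])
       (auto simp: nn_integral_density)
  finally show ?thesis .
qed

lemma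
  fixes l :: "'v::finite \<Rightarrow> real" and \<xi> :: "'v \<Rightarrow> 'a \<Rightarrow> real"
  assumes "prob_space M"
    and indep: "prob_space.indep_vars M (\<lambda>_. borel) \<xi> UNIV"
    and dist: "\<And>i. distributed M lborel (\<xi> i) (\<lambda>x. ennreal (gumbel_density x))"
  shows measure_wm_event: "measure M (wm_event M l \<xi> w) = softmax l w" (is ?measure)
    and cond_expectation_wm_event: "\<And>g. g \<in> borel_measurable borel \<Longrightarrow>
      cond_expectation M (wm_event M l \<xi> w) (\<lambda>\<omega>. g (\<xi> w \<omega>))
        = (\<integral>x. g (x - ln (softmax l w)) \<partial>gumbel)"
proof -
  interpret prob_space M by fact
  interpret G: prob_space gumbel by (rule prob_space_gumbel)
  let ?p = "softmax l w" and ?A = "wm_event M l \<xi> w"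
  note p = softmax_pos[of l w]
  have rv[measurable]: "\<xi> i \<in> borel_measurable M" for i
    using dist[of i] by (simp add: distributed_def)
  have A[measurable]: "?A \<in> sets M"
    unfolding wm_event_def by measurable
  have "emeasure M ?A = ennreal ?p"
    using nn_integral_wm_event[OF assms, of "\<lambda>_. 1" l w] G.emeasure_space_1 by simp
  then show m: ?measure
    using p by (simp add: measure_def)
  let ?N = "distr gumbel borel (\<lambda>x. x - ln ?p)"
  \<comment> \<open>An equality of measures transfers Bochner integrals of every Borel
    \<open>g\<close>, integrable or not. The factor \<open>?p\<close> then cancels against the
    probability of the event.\<close>
  have eq: "distr (density M (\<lambda>\<omega>. ennreal (indicator ?A \<omega>))) borel (\<xi> w) = density ?N (\<lambda>_. ennreal ?p)"
  proof (rule measure_eqI)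
    fix B assume "B \<in> sets (distr (density M (\<lambda>\<omega>. ennreal (indicator ?A \<omega>))) borel (\<xi> w))"
    then have B[measurable]: "B \<in> sets borel" by simp
    have "emeasure (distr (density M (\<lambda>\<omega>. ennreal (indicator ?A \<omega>))) borel (\<xi> w)) B
        = (\<integral>\<^sup>+\<omega>. indicator ?A \<omega> * indicator B (\<xi> w \<omega>) \<partial>M)"
      by (subst emeasure_distr; simp add: emeasure_density)
         (auto intro!: nn_integral_cong simp: indicator_def)
    also have "\<dots> = ennreal ?p * (\<integral>\<^sup>+x. indicator B (x - ln ?p) \<partial>gumbel)"
      by (intro nn_integral_wm_event assms) auto
    also have "(\<integral>\<^sup>+x. indicator B (x - ln ?p) \<partial>gumbel) = emeasure ?N B"
      by (subst nn_integral_indicator[symmetric], simp) (subst nn_integral_distr, auto)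
    finally show "emeasure (distr (density M (\<lambda>\<omega>. ennreal (indicator ?A \<omega>))) borel (\<xi> w)) B
        = emeasure (density ?N (\<lambda>_. ennreal ?p)) B"
      by (simp add: emeasure_density_const)
  qed simp
  fix g :: "real \<Rightarrow> real" assume g[measurable]: "g \<in> borel_measurable borel"
  have "(\<integral>\<omega>. indicator ?A \<omega> * g (\<xi> w \<omega>) \<partial>M)
      = (\<integral>x. g x \<partial>distr (density M (\<lambda>\<omega>. ennreal (indicator ?A \<omega>))) borel (\<xi> w))"
    by (simp add: integral_distr integral_real_density)
  also have "\<dots> = ?p * (\<integral>x. g (x - ln ?p) \<partial>gumbel)"
    unfolding eq using p by (simp add: integral_real_density integral_distr)
  finally show "cond_expectation M ?A (\<lambda>\<omega>. g (\<xi> w \<omega>)) = (\<integral>x. g (x - ln ?p) \<partial>gumbel)"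
    using p unfolding cond_expectation_def m by simp
qed

section \<open>Score of a token chosen independently of the key\<close>

text \<open>The integrand is split according to the value of \<open>W\<close>. For each
  \<open>v\<close>, independence factors the integral of
  \<open>indicator {v} (W \<omega>) * g (\<xi> v \<omega>)\<close>; the second factor does not
  depend on \<open>v\<close>, and the indicators sum to 1.\<close>

lemma integral_indep_selection:
  fixes \<xi> :: "'v::finite \<Rightarrow> 'a \<Rightarrow> real" and g :: "real \<Rightarrow> real"
  assumes "prob_space M"
    and W: "W \<in> measurable M (count_space UNIV)"
    and indep: "prob_space.indep_set M {W -` A \<inter> space M | A. True}
       {(\<lambda>\<omega> i. \<xi> i \<omega>) -` B \<inter> space M | B. B \<in> sets (\<Pi>\<^sub>M i\<in>UNIV. borel)}"
    and dist: "\<And>i. distributed M lborel (\<xi> i) (\<lambda>x. ennreal (gumbel_density x))"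
    and g[measurable]: "g \<in> borel_measurable borel" and g_int: "integrable gumbel g"
  shows "(\<integral>\<omega>. g (\<xi> (W \<omega>) \<omega>) \<partial>M) = (\<integral>x. g x \<partial>gumbel)"
proof -
  interpret prob_space M by fact
  note W[measurable]
  have rv[measurable]: "\<xi> i \<in> borel_measurable M" for i
    using dist[of i] by (simp add: distributed_def)
  have D: "distr M borel (\<xi> i) = gumbel" for i
    using dist[of i] by (simp add: distributed_def cong: distr_cong)
  have int_g: "integrable M (\<lambda>\<omega>. g (\<xi> v \<omega>))" "(\<integral>\<omega>. g (\<xi> v \<omega>) \<partial>M) = (\<integral>x. g x \<partial>gumbel)" for v
    using g_int D[of v] integrable_distr_eq[of "\<xi> v" M borel g] integral_distr[of "\<xi> v" M borel g] by auto
  \<comment> \<open>Needed to extend independence from these preimages to the sigma-algebras they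
    generate, as \<open>indep_var_eq\<close> demands.\<close>
  have stable: "Int_stable {f -` A \<inter> space M |A. A \<in> sets borel}" for f :: "'a \<Rightarrow> real"
    unfolding Int_stable_def
  proof safe
    fix A B :: "real set" assume "A \<in> sets borel" "B \<in> sets borel"
    then show "\<exists>C. (f -` A \<inter> space M) \<inter> (f -` B \<inter> space M) = f -` C \<inter> space M \<and> C \<in> sets borel"
      by (intro exI[of _ "A \<inter> B"]) auto
  qed
  have iv: "indep_var borel (\<lambda>\<omega>. indicator {v} (W \<omega>) :: real) borel (\<lambda>\<omega>. g (\<xi> v \<omega>))" for v
    unfolding indep_var_eq
  proof (intro conjI indep_set_sigma_sets stable)
    show "indep_set {(\<lambda>\<omega>. indicator {v} (W \<omega>) :: real) -` A \<inter> space M |A. A \<in> sets borel}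
       {(\<lambda>\<omega>. g (\<xi> v \<omega>)) -` A \<inter> space M |A. A \<in> sets borel}"
      unfolding indep_sets2_eq
    proof (intro conjI ballI)
      fix a b
      assume "a \<in> {(\<lambda>\<omega>. indicator {v} (W \<omega>) :: real) -` A \<inter> space M |A. A \<in> sets borel}"
        and "b \<in> {(\<lambda>\<omega>. g (\<xi> v \<omega>)) -` A \<inter> space M |A. A \<in> sets borel}"
      then obtain A B where a: "a = (\<lambda>\<omega>. indicator {v} (W \<omega>) :: real) -` A \<inter> space M"
        and b: "b = (\<lambda>\<omega>. g (\<xi> v \<omega>)) -` B \<inter> space M" and B: "B \<in> sets borel"
        by auto
      \<comment> \<open>An event about the single coordinate \<open>v\<close> is viewed as an event
        about the whole key, which is what the independence hypothesis covers.\<close>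
      have "(\<lambda>y. g (y v)) -` B \<inter> space (Pi\<^sub>M UNIV (\<lambda>_::'v. borel)) \<in> sets (Pi\<^sub>M UNIV (\<lambda>_. borel))"
        using B by (intro measurable_sets[of _ _ borel] measurable_compose[OF _ g] measurable_component_singleton) auto
      then have "b \<in> {(\<lambda>\<omega> i. \<xi> i \<omega>) -` B \<inter> space M | B. B \<in> sets (\<Pi>\<^sub>M i\<in>UNIV. borel)}"
        unfolding b by (intro CollectI exI[of _ "(\<lambda>y. g (y v)) -` B"]) (auto simp: space_PiM)
      moreover have "a \<in> {W -` A \<inter> space M | A. True}"
        unfolding a by (intro CollectI exI[of _ "indicator {v} -` A"]) auto
      ultimately show "prob (a \<inter> b) = prob a * prob b"
        by (intro indep_setD[OF indep])
    qed auto
  qed auto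
  have int_W: "integrable M (\<lambda>\<omega>. indicator {v} (W \<omega>) :: real)" for v
    by (rule integrable_const_bound[of _ 1]) (auto simp: indicator_def)
  have "(\<integral>\<omega>. g (\<xi> (W \<omega>) \<omega>) \<partial>M) = (\<integral>\<omega>. (\<Sum>v\<in>UNIV. indicator {v} (W \<omega>) * g (\<xi> v \<omega>)) \<partial>M)"
    by (simp add: indicator_def if_distrib[of "\<lambda>c. c * _"] cong: if_cong)
  also have "\<dots> = (\<Sum>v\<in>UNIV. \<integral>\<omega>. indicator {v} (W \<omega>) * g (\<xi> v \<omega>) \<partial>M)"
    by (intro Bochner_Integration.integral_sum indep_var_integrable[OF iv int_W int_g(1)])
  also have "\<dots> = (\<Sum>v\<in>UNIV. (\<integral>\<omega>. indicator {v} (W \<omega>) \<partial>M) * (\<integral>x. g x \<partial>gumbel))"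
    using indep_var_lebesgue_integral[OF iv int_W int_g(1)] int_g(2) by simp
  also have "\<dots> = (\<integral>\<omega>. (\<Sum>v\<in>UNIV. indicator {v} (W \<omega>)) \<partial>M) * (\<integral>x. g x \<partial>gumbel)"
    using int_W by (simp add: sum_distrib_right)
  also have "(\<lambda>\<omega>. \<Sum>v\<in>UNIV. indicator {v} (W \<omega>) :: real) = (\<lambda>_. 1)"
    by (simp add: indicator_def)
  finally show ?thesis
    by (simp add: prob_space)
qed

section \<open>The numerical bound and the final assembly\<close>

text \<open>The first fraction is only used as nonnegative. Expanding the square cancels
  \<open>x\<^sup>2\<close> against the Taylor bound and leaves
  \<open>2 + 2 * x * (1 - ?g) - ?g\<^sup>2\<close>, which is at least
  \<open>2 - ?g\<^sup>2\<close>.\<close>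

lemma gumbel_variance_le_bound:
  fixes p :: real
  assumes p: "0 < p" "p < 1"
  shows "pi\<^sup>2 / 6 \<le> 2 * p\<^sup>2 / (1 - p) ^ 3 + 2 / p - (- ln p + euler_mascheroni)\<^sup>2"
proof -
  let ?g = "euler_mascheroni :: real"
  define x where "x = - ln p"
  have x: "0 \<le> x" "1 / p = exp x"
    using p by (auto simp: x_def exp_minus field_simps)
  have "1 + x + x\<^sup>2 / 2 \<le> 1 / p"
    unfolding x(2) using x(1) by (rule exp_lower_Taylor_quadratic)
  \<comment> \<open>The constant is 9.885, just above the square of 3.144. A sixth of it plus
    \<open>169 / 484\<close>, the square of 13/22, is below 1.997, hence below 2.\<close>
  moreover have "pi\<^sup>2 \<le> 1977 / 200"
    using pi_approx power_mono[of pi "3.144" 2] by (simp add: power2_eq_square)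
  moreover have "?g\<^sup>2 \<le> 169 / 484"
    using euler_mascheroni_less_13_over_22 euler_mascheroni_pos power_mono[of ?g "13 / 22" 2]
    by (simp add: power2_eq_square)
  moreover have "2 / p = 2 * (1 / p)" by simp
  moreover have "x * ?g \<le> x * 1"
    using x euler_mascheroni_less_13_over_22 by (intro mult_left_mono) auto
  moreover have "0 \<le> 2 * p\<^sup>2 / (1 - p) ^ 3"
    using p by simp
  moreover have "(- ln p + ?g)\<^sup>2 = x\<^sup>2 + 2 * (x * ?g) + ?g\<^sup>2"
    by (simp add: x_def power2_eq_square algebra_simps)
  ultimately show ?thesis
    by linarith
qed

theorem theorem1:
  fixes M :: "'a measure"
    and l :: "'v::finite \<Rightarrow> real"
    and \<xi> :: "'v \<Rightarrow> 'a \<Rightarrow> real"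
  assumes "prob_space M"
    and "CARD('v) \<ge> 2"
    and "prob_space.indep_vars M (\<lambda>_. borel) \<xi> UNIV"
    and "\<And>i. distributed M lborel (\<xi> i) (\<lambda>x. ennreal (gumbel_density x))"
  shows "(\<forall>w. cond_expectation M (wm_event M l \<xi> w) (\<xi> w)
                = - ln (softmax l w) + euler_mascheroni
            \<and> cond_variance M (wm_event M l \<xi> w) (\<xi> w)
                \<le> 2 * (softmax l w)\<^sup>2 / (1 - softmax l w) ^ 3 + 2 / softmax l w
                   - (- ln (softmax l w) + euler_mascheroni)\<^sup>2)
       \<and> (\<forall>W.
            (W :: 'a \<Rightarrow> 'v) \<in> measurable M (count_space UNIV)
            \<and> prob_space.indep_set M
                 {W -` A \<inter> space M | A. True}
                 {(\<lambda>\<omega> i. \<xi> i \<omega>) -` B \<inter> space M | B. B \<in> sets (Pi\<^sub>M UNIV (\<lambda>_. borel))}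
            \<longrightarrow> (let s = (\<lambda>\<omega>. \<xi> (W \<omega>) \<omega>) in
                   (\<integral>\<omega>. s \<omega> \<partial>M) = euler_mascheroni
                 \<and> (\<integral>\<omega>. (s \<omega> - (\<integral>\<omega>'. s \<omega>' \<partial>M))\<^sup>2 \<partial>M) = pi\<^sup>2 / 6))"
proof (intro conjI allI impI)
  note cond = cond_expectation_wm_event[OF assms(1,3,4)]
  fix w
  let ?p = "softmax l w" and ?A = "wm_event M l \<xi> w"
  show mean: "cond_expectation M ?A (\<xi> w) = - ln ?p + euler_mascheroni"
    using cond[of "\<lambda>x. x" l w] by (simp add: gumbel_mean_shift)
  \<comment> \<open>The shift \<open>- ln ?p\<close> of the score cancels against the same shift in
    its conditional mean.\<close>
  have "cond_variance M ?A (\<xi> w) = (\<integral>x. (x - euler_mascheroni)\<^sup>2 \<partial>gumbel)"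
    unfolding cond_variance_def mean
    using cond[of "\<lambda>x. (x - (- ln ?p + euler_mascheroni))\<^sup>2" l w] by simp
  then show "cond_variance M ?A (\<xi> w) \<le> 2 * ?p\<^sup>2 / (1 - ?p) ^ 3 + 2 / ?p - (- ln ?p + euler_mascheroni)\<^sup>2"
    using gumbel_variance_le_bound[OF softmax_pos[of l w] softmax_less_1[OF assms(2)]]
    by (simp add: gumbel_variance)
next
  fix W :: "'a \<Rightarrow> 'v"
  assume W: "W \<in> measurable M (count_space UNIV) \<and> prob_space.indep_set M
                 {W -` A \<inter> space M | A. True}
                 {(\<lambda>\<omega> i. \<xi> i \<omega>) -` B \<inter> space M | B. B \<in> sets (Pi\<^sub>M UNIV (\<lambda>_. borel))}"
  interpret G: prob_space gumbel by (rule prob_space_gumbel)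
  have sel: "(\<integral>\<omega>. g (\<xi> (W \<omega>) \<omega>) \<partial>M) = (\<integral>x. g x \<partial>gumbel)"
    if "g \<in> borel_measurable borel" "integrable gumbel g" for g :: "real \<Rightarrow> real"
    using W that by (intro integral_indep_selection[where \<xi>=\<xi> and W=W and g=g and M=M] assms) blast+
  have int: "integrable gumbel (\<lambda>x. x)" "integrable gumbel (\<lambda>x. x\<^sup>2)"
    using gumbel_integrable_power[of 1] gumbel_integrable_power[of 2] by simp_all
  have mean: "(\<integral>\<omega>. \<xi> (W \<omega>) \<omega> \<partial>M) = euler_mascheroni"
    using sel[OF _ int(1)] by (simp add: gumbel_mean)
  \<comment> \<open>The centred square in the form that \<open>power2_diff\<close> produces;
    \<open>sel\<close> asks for its integrability.\<close>
  have "integrable gumbel (\<lambda>x. x\<^sup>2 + euler_mascheroni\<^sup>2 - 2 * x * euler_mascheroni)"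
    by (intro Bochner_Integration.integrable_diff Bochner_Integration.integrable_add
        integrable_mult_left integrable_mult_right int G.integrable_const)
  then have "integrable gumbel (\<lambda>x. (x - euler_mascheroni)\<^sup>2)"
    by (simp only: power2_diff)
  then have var: "(\<integral>\<omega>. (\<xi> (W \<omega>) \<omega> - euler_mascheroni)\<^sup>2 \<partial>M) = pi\<^sup>2 / 6"
    using sel[of "\<lambda>x. (x - euler_mascheroni)\<^sup>2"] by (simp add: gumbel_variance)
  show "let s = (\<lambda>\<omega>. \<xi> (W \<omega>) \<omega>) in
                   (\<integral>\<omega>. s \<omega> \<partial>M) = euler_mascheroni
                 \<and> (\<integral>\<omega>. (s \<omega> - (\<integral>\<omega>'. s \<omega>' \<partial>M))\<^sup>2 \<partial>M) = pi\<^sup>2 / 6"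
    unfolding Let_def mean var by simp
qed

end
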